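(* Let $\Omega\subset\mathbb{R}^n$ ($n\ge2$) be a bounded, convex open set. Then, for every $t>0$, the function \[ (x,z)\mapsto p^\Omega_\gamma(x,z;t)\,e^{-|z|^2/2},\qquad (x,z)\in\Omega\times\Omega, \] is log-concave.
   Context: $(\cdot,\cdot)$ is the Euclidean scalar product and $|\cdot|$ the Euclidean norm. $\gamma$ is the Gaussian probability measure on $\mathbb{R}^n$, $d\gamma(x)=(2\pi)^{-n/2}e^{-|x|^2/2}\,dx$. The Ornstein–Uhlenbeck operator in $\Omega$ is $L_\Omega u=\Delta u-(x,\nabla u)$ with Dirichlet domain $\{u\in W^{1,2}_0(\Omega,\gamma): \Delta u\in L^2(\Omega,\gamma)\}$, where $W^{1,2}_0(\Omega,\gamma)$ is the closure of $C^\infty_c(\Omega)$ in the norm $\left(\int_\Omega(|\nabla u|^2+u^2)\,d\gamma\right)^{1/2}$. This operator generates a semigroup $T(t)$, $t\ge0$, on $L^2(\Omega,\gamma)$ (so that $u(\cdot,t)=T(t)f$ solves $u_t=L_\Omega u$, $u=0$ on $\partial\Omega$, $u(\cdot,0)=f$), and $p^\Omega_\gamma$ is its kernel with respect to $\gamma$: $(T(t)f)(x)=\int_\Omega p^\Omega_\gamma(x,z;t)f(z)\,d\gamma(z)$ for all $f\in L^2(\Omega,\gamma)$. Equivalently, $p^\Omega_\gamma$ is the solution of $\Delta_x p-(x,\nabla_x p)=\partial_t p$ in $\Omega\times\Omega\times(0,\infty)$, $p(x,z;t)=0$ if $x\in\partial\Omega$ or $z\in\partial\Omega$, $p(x,z;0)\,d\gamma(z)=\delta(x-z)$.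 A nonnegative function is log-concave if its logarithm is concave (with $\log0=-\infty$). *)

theory Defs
  imports "HOL-Analysis.Analysis"
begin

definition gauss_dens :: "real^'n \<Rightarrow> real" where
  "gauss_dens z = (2 * pi) powr (- real CARD('n) / 2) * exp (- (norm z)\<^sup>2 / 2)"

definition OU_heat_eq :: "(real^'n) set \<Rightarrow> (real^'n \<Rightarrow> real \<Rightarrow> real) \<Rightarrow> bool" where
  "OU_heat_eq \<Omega> u \<longleftrightarrow>
     (\<forall>y\<in>\<Omega>. \<forall>s>0. \<exists>G :: real^'n \<Rightarrow> real^'n. \<exists>H :: real^'n^'n. \<exists>ut :: real.
        (\<forall>w\<in>\<Omega>. ((\<lambda>v. u v s) has_derivative (\<lambda>h. G w \<bullet> h)) (at w)) \<and>
        (G has_derivative (\<lambda>h. H *v h)) (at y) \<and>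
        ((\<lambda>r. u y r) has_real_derivative ut) (at s) \<and>
        ut = (\<Sum>i\<in>UNIV. H $ i $ i) - y \<bullet> G y)"

definition Cc_on :: "(real^'n) set \<Rightarrow> (real^'n \<Rightarrow> real) \<Rightarrow> bool" where
  "Cc_on \<Omega> f \<longleftrightarrow> continuous_on UNIV f \<and>
     (\<exists>K. compact K \<and> K \<subseteq> \<Omega> \<and> (\<forall>z. z \<notin> K \<longrightarrow> f z = 0))"

definition kernel_sol ::
  "(real^'n) set \<Rightarrow> (real^'n \<Rightarrow> real^'n \<Rightarrow> real \<Rightarrow> real) \<Rightarrow> (real^'n \<Rightarrow> real)
     \<Rightarrow> real^'n \<Rightarrow> real \<Rightarrow> real" where
  "kernel_sol \<Omega> p f x t =
     (if t = 0 then f x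
      else if x \<in> \<Omega> then integral \<Omega> (\<lambda>z. p x z t * f z * gauss_dens z)
      else 0)"

text \<open>p is the Dirichlet heat kernel (w.r.t. gamma) of the Ornstein-Uhlenbeck operator in
  Omega: p is continuous on Omega x Omega x (0,inf), and for every continuous compactly
  supported initial datum f the function x,t |-> integral p(x,z;t) f(z) dgamma(z) is the
  (classical) solution of u_t = L u in Omega x (0,inf), u = 0 on the boundary, u(.,0) = f,
  continuous on closure(Omega) x [0,inf).\<close>
definition OU_dirichlet_kernel ::
  "(real^'n) set \<Rightarrow> (real^'n \<Rightarrow> real^'n \<Rightarrow> real \<Rightarrow> real) \<Rightarrow> bool" where
  "OU_dirichlet_kernel \<Omega> p \<longleftrightarrow>
     continuous_on (\<Omega> \<times> \<Omega> \<times> {0<..}) (\<lambda>(x, z, t). p x z t) \<and>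
     (\<forall>f. Cc_on \<Omega> f \<longrightarrow>
        (\<forall>x\<in>\<Omega>. \<forall>t>0. (\<lambda>z. p x z t * f z * gauss_dens z) integrable_on \<Omega>) \<and>
        continuous_on (closure \<Omega> \<times> {0..}) (\<lambda>(x, t). kernel_sol \<Omega> p f x t) \<and>
        OU_heat_eq \<Omega> (kernel_sol \<Omega> p f))"

definition log_concave_on :: "'a::real_vector set \<Rightarrow> ('a \<Rightarrow> real) \<Rightarrow> bool" where
  "log_concave_on C g \<longleftrightarrow>
     (\<forall>x\<in>C. g x \<ge> 0) \<and>
     (let L = (\<lambda>x. if g x = 0 then (-\<infinity> :: ereal) else ereal (ln (g x))) in
       (\<forall>a\<in>C. \<forall>b\<in>C. \<forall>s::real. 0 < s \<and> s < 1 \<longrightarrow>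
          L ((1 - s) *\<^sub>R a + s *\<^sub>R b) \<ge> ereal (1 - s) * L a + ereal s * L b))"

end

theory Submission
  imports Defs
begin

text \<open>
  A parabolic Prekopa--Leindler principle: if \<open>u\<^sub>0, u\<^sub>1, u\<^sub>\<lambda>\<close> are nonnegative Dirichlet solutions whose
  initial data satisfy \<open>u\<^sub>0(x)\<^sup>1\<^sup>-\<^sup>\<lambda> u\<^sub>1(y)\<^sup>\<lambda> \<le> u\<^sub>\<lambda>((1-\<lambda>)x + \<lambda>y)\<close>, then the inequality persists
  for all times. To see this, maximise the quotient
  \<open>u\<^sub>0(x,t)\<^sup>1\<^sup>-\<^sup>\<lambda> u\<^sub>1(y,t)\<^sup>\<lambda> / (u\<^sub>\<lambda>((1-\<lambda>)x + \<lambda>y, t) + c(1+t))\<close> with \<open>c > 0\<close>. At an interior maximum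
  the gradients of the three logarithms agree, so the quadratic and the drift terms of
  \<open>w\<^sub>t = \<Delta>w + |\<nabla>w|\<^sup>2 - (x,\<nabla>w)\<close> cancel; moving \<open>x\<close> and \<open>y\<close> in the same direction controls the
  Laplacians, and the term with \<open>c\<close> yields a contradiction in the time derivative. Since the quotient
  vanishes on the lateral boundary, no boundary regularity is needed.

  Applied to translates \<open>\<phi>((\<cdot> - z\<^sub>i)/r)\<close> of one log-concave bump centred at \<open>z\<^sub>0, z\<^sub>1, (1-\<lambda>)z\<^sub>0 + \<lambda>z\<^sub>1\<close>,
  the principle gives the joint log-concavity in \<open>(x,z)\<close> as \<open>r \<rightarrow> 0\<close>; the factor \<open>exp(-|z|\<^sup>2/2)\<close> is
  the density of \<open>\<gamma>\<close> against which the kernel is integrated.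
\<close>

section \<open>Local calculus, and the evolution equation of the logarithm of a solution\<close>

lemma isCont_eventually_pos:
  fixes f :: "'a::t2_space \<Rightarrow> real"
  assumes "isCont f a" "0 < f a"
  shows "\<forall>\<^sub>F x in nhds a. 0 < f x"
proof -
  have "(f \<longlongrightarrow> f a) (nhds a)"
    using assms(1) by (simp add: isCont_def tendsto_at_iff_tendsto_nhds)
  then show ?thesis using assms(2) by (rule order_tendstoD(1))
qed

text \<open>If \<open>D\<close> were negative, \<open>d\<close>, which vanishes at the minimum,
  would be negative just to the right of 0, and the mean value theorem would push \<open>f\<close>
  below \<open>f 0\<close>. Differentiability of \<open>d\<close> is asked at 0 only, since
  \<open>OU_heat_eq\<close> gives a Hessian at one point and no continuity of second
  derivatives.\<close>

lemma second_deriv_local_min: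
  fixes f d :: "real \<Rightarrow> real"
  assumes f: "\<forall>\<^sub>F \<tau> in nhds 0. (f has_real_derivative d \<tau>) (at \<tau>)"
    and d: "(d has_real_derivative D) (at 0)"
    and min: "\<forall>\<^sub>F \<tau> in nhds 0. f 0 \<le> f \<tau>"
  shows "0 \<le> D"
proof (rule ccontr)
  assume "\<not> 0 \<le> D"
  then have "D < 0" by simp
  obtain e where "e > 0" and e: "\<And>\<tau>. \<bar>\<tau>\<bar> < e \<Longrightarrow> (f has_real_derivative d \<tau>) (at \<tau>) \<and> f 0 \<le> f \<tau>"
    using eventually_conj[OF f min] unfolding eventually_nhds_metric by (auto simp: dist_real_def)
  have "d 0 = 0"
    using DERIV_local_min[of f "d 0" 0 e] e \<open>e > 0\<close> by auto
  obtain k where "k > 0" and k: "\<And>h. 0 < h \<Longrightarrow> h < k \<Longrightarrow> d h < 0"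
    using DERIV_neg_dec_right[OF d \<open>D < 0\<close>] \<open>d 0 = 0\<close> by auto
  define h where "h = min e k / 2"
  have h: "0 < h" "h < e" "h < k" using \<open>e > 0\<close> \<open>k > 0\<close> by (auto simp: h_def)
  obtain \<xi> where \<xi>: "0 < \<xi>" "\<xi> < h" "f h - f 0 = (h - 0) * d \<xi>"
    using MVT2[of 0 h f d] h e by auto
  have "h * d \<xi> < 0" using k[of \<xi>] \<xi> h by (simp add: mult_pos_neg)
  then show False using e[of h] h \<xi> by auto
qed

text \<open>\<open>d i\<close> and \<open>q i\<close> are the first derivative along, respectively the second derivative at \<open>y\<close> in, the
  \<open>i\<close>-th coordinate direction of \<open>ln U\<close>. The term \<open>c * (1 + r)\<close> turns the solution into a strict
  supersolution that is positive on the boundary.\<close>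

lemma OU_heat_eq_log:
  fixes u U :: "real^'n \<Rightarrow> real \<Rightarrow> real" and c :: real
  assumes U_def: "U = (\<lambda>v r. u v r + c * (1 + r))"
    and eq: "OU_heat_eq \<Omega> u" and "open \<Omega>" "y \<in> \<Omega>" "s > 0" and pos: "U y s > 0"
  obtains g :: "real^'n" and d :: "'n \<Rightarrow> real \<Rightarrow> real" and q :: "'n \<Rightarrow> real" and wt :: real
  where "((\<lambda>v. ln (U v s)) has_derivative (\<lambda>h. g \<bullet> h)) (at y)"
    and "\<And>i. \<forall>\<^sub>F \<tau> in nhds 0.
           ((\<lambda>\<tau>. ln (U (y + \<tau> *\<^sub>R axis i 1) s)) has_real_derivative d i \<tau>) (at \<tau>)"
    and "\<And>i. (d i has_real_derivative q i) (at 0)"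
    and "((\<lambda>r. ln (U y r)) has_real_derivative wt) (at s)"
    and "wt = (\<Sum>i\<in>UNIV. q i) + g \<bullet> g - y \<bullet> g + c / U y s"
    and "\<forall>\<^sub>F v in nhds y. v \<in> \<Omega> \<and> U v s > 0"
    and "\<forall>\<^sub>F r in nhds s. U y r > 0"
proof -
  obtain G :: "real^'n \<Rightarrow> real^'n" and H :: "real^'n^'n" and ut :: real where
    G: "\<And>w. w \<in> \<Omega> \<Longrightarrow> ((\<lambda>v. u v s) has_derivative (\<lambda>h. G w \<bullet> h)) (at w)"
    and H: "(G has_derivative (\<lambda>h. H *v h)) (at y)"
    and ut: "((\<lambda>r. u y r) has_real_derivative ut) (at s)"
    and ut_eq: "ut = (\<Sum>i\<in>UNIV. H $ i $ i) - y \<bullet> G y"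
    using eq \<open>y \<in> \<Omega>\<close> \<open>s > 0\<close> unfolding OU_heat_eq_def by blast
  have GU: "((\<lambda>v. U v s) has_derivative (\<lambda>h. G w \<bullet> h)) (at w)" if "w \<in> \<Omega>" for w
    unfolding U_def using has_derivative_add[OF G[OF that] has_derivative_const] by simp
  have utU: "((\<lambda>r. U y r) has_real_derivative (ut + c)) (at s)"
    unfolding U_def by (auto intro!: derivative_eq_intros ut)
  have ev_\<Omega>: "\<forall>\<^sub>F v in nhds y. v \<in> \<Omega>"
    using \<open>open \<Omega>\<close> \<open>y \<in> \<Omega>\<close> by (rule eventually_nhds_in_open)
  have "isCont (\<lambda>v. U v s) y"
    using GU[OF \<open>y \<in> \<Omega>\<close>] by (rule has_derivative_continuous)
  then have "\<forall>\<^sub>F v in nhds y. U v s > 0"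
    using pos by (rule isCont_eventually_pos)
  then have ev1: "\<forall>\<^sub>F v in nhds y. v \<in> \<Omega> \<and> U v s > 0"
    using ev_\<Omega> by (simp add: eventually_conj)
  have "isCont (\<lambda>r. U y r) s"
    using utU by (rule DERIV_isCont)
  then have ev2: "\<forall>\<^sub>F r in nhds s. U y r > 0"
    using pos by (rule isCont_eventually_pos)
  define g where "g = G y /\<^sub>R U y s"
  define d where "d = (\<lambda>i \<tau>. G (y + \<tau> *\<^sub>R axis i 1) $ i / U (y + \<tau> *\<^sub>R axis i 1) s)"
  define q where "q = (\<lambda>i. H $ i $ i / U y s - (G y $ i / U y s)\<^sup>2)"
  define wt where "wt = (ut + c) / U y s"
  show thesis
  proof (rule that)
    show "((\<lambda>v. ln (U v s)) has_derivative (\<lambda>h. g \<bullet> h)) (at y)"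
      by (rule has_derivative_eq_rhs, rule has_derivative_ln[OF pos GU[OF \<open>y \<in> \<Omega>\<close>]])
         (use pos in \<open>auto simp: g_def fun_eq_iff field_simps\<close>)
    have line: "((\<lambda>\<tau>. y + \<tau> *\<^sub>R axis i 1) has_derivative (\<lambda>h. h *\<^sub>R axis i 1)) (at \<tau>)"
      for i :: 'n and \<tau> :: real
      by (auto intro!: derivative_eq_intros)
    have dU: "((\<lambda>\<tau>. U (y + \<tau> *\<^sub>R axis i 1) s) has_real_derivative G (y + \<tau> *\<^sub>R axis i 1) $ i) (at \<tau>)"
      if "y + \<tau> *\<^sub>R axis i 1 \<in> \<Omega>" for i :: 'n and \<tau> :: real
      unfolding has_field_derivative_def
      by (rule has_derivative_eq_rhs[OF has_derivative_compose[OF line GU[OF that]]])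
         (auto simp: fun_eq_iff inner_axis)
    show "\<forall>\<^sub>F \<tau> in nhds 0.
        ((\<lambda>\<tau>. ln (U (y + \<tau> *\<^sub>R axis i 1) s)) has_real_derivative d i \<tau>) (at \<tau>)" for i
    proof -
      have "((\<lambda>\<tau>::real. y + \<tau> *\<^sub>R axis i 1) \<longlongrightarrow> y + 0 *\<^sub>R axis i 1) (nhds 0)"
        by (intro tendsto_intros filterlim_ident)
      then have "\<forall>\<^sub>F \<tau> in nhds (0::real). y + \<tau> *\<^sub>R axis i 1 \<in> \<Omega> \<and> U (y + \<tau> *\<^sub>R axis i 1) s > 0"
        using filterlim_iff[THEN iffD1, rule_format, OF _ ev1] by simp
      then show ?thesis
      proof eventually_elim
        case (elim \<tau>)
        then show ?case
          unfolding d_def by (auto intro!: derivative_eq_intros dU simp: field_simps)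
      qed
    qed
    show "(d i has_real_derivative q i) (at 0)" for i
    proof -
      have "(G has_derivative (\<lambda>h. H *v h)) (at (y + 0 *\<^sub>R axis i 1))"
        using H by simp
      from has_derivative_compose[OF line this]
      have "((\<lambda>\<tau>. G (y + \<tau> *\<^sub>R axis i 1) $ i) has_derivative (\<lambda>h. (H *v (h *\<^sub>R axis i 1)) $ i)) (at 0)"
        by (rule bounded_linear.has_derivative[OF bounded_linear_vec_nth])
      moreover have "(\<lambda>h. (H *v (h *\<^sub>R axis i 1)) $ i) = (*) (H $ i $ i)"
        by (auto simp: fun_eq_iff matrix_vector_mult_scaleR matrix_vector_mult_basis column_def)
      ultimately have "((\<lambda>\<tau>. G (y + \<tau> *\<^sub>R axis i 1) $ i) has_real_derivative H $ i $ i) (at 0)"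
        by (simp add: has_field_derivative_def)
      from DERIV_divide[OF this dU[of 0 i]] pos \<open>y \<in> \<Omega>\<close> show ?thesis
        unfolding d_def q_def
        by (auto elim!: DERIV_cong simp: field_simps power2_eq_square)
    qed
    show "((\<lambda>r. ln (U y r)) has_real_derivative wt) (at s)"
      unfolding wt_def using pos by (auto intro!: derivative_eq_intros utU simp: field_simps)
    \<comment> \<open>The Laplacian of ln U is (Laplacian of U) / U minus |g|^2; solving this for
      the first term puts \<open>+ g \<bullet> g\<close> into the equation for
      \<open>wt\<close>.\<close>
    have "(\<Sum>i\<in>UNIV. (G y $ i / U y s)\<^sup>2) = g \<bullet> g"
      unfolding g_def inner_vec_def by (simp add: power2_eq_square divide_inverse mult_ac)
    then have "(\<Sum>i\<in>UNIV. q i) = (\<Sum>i\<in>UNIV. H $ i $ i) / U y s - g \<bullet> g"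
      unfolding q_def by (simp add: sum_subtractf sum_divide_distrib)
    then show "wt = (\<Sum>i\<in>UNIV. q i) + g \<bullet> g - y \<bullet> g + c / U y s"
      unfolding wt_def ut_eq g_def using pos by (simp add: field_simps)
  qed (fact ev1 ev2)+
qed

section \<open>The interior maximum argument for the two-point quotient\<close>

text \<open>Maximality is asked only for times up to \<open>s\<close>, because the contradiction
  comes from going slightly back in time. Hence \<open>s\<close> may be the final time of a closed
  time interval.\<close>

lemma OU_no_interior_max:
  fixes u0 u1 ul :: "real^'n \<Rightarrow> real \<Rightarrow> real" and c l :: real
  defines "U \<equiv> \<lambda>v r. ul v r + c * (1 + r)"
  assumes eqs: "OU_heat_eq \<Omega> u0" "OU_heat_eq \<Omega> u1" "OU_heat_eq \<Omega> ul"
    and \<Omega>: "open \<Omega>" "convex \<Omega>" and l: "0 < l" "l < 1" and "c > 0"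
    and pt: "x \<in> \<Omega>" "y \<in> \<Omega>" "s > 0"
    and pos: "u0 x s > 0" "u1 y s > 0" "\<And>v r. v \<in> \<Omega> \<Longrightarrow> 0 < r \<Longrightarrow> r \<le> s \<Longrightarrow> U v r > 0"
    and max: "\<And>v w r. v \<in> \<Omega> \<Longrightarrow> w \<in> \<Omega> \<Longrightarrow> 0 < r \<Longrightarrow> r \<le> s \<Longrightarrow>
      u0 v r powr (1 - l) * u1 w r powr l / U ((1 - l) *\<^sub>R v + l *\<^sub>R w) r \<le>
      u0 x s powr (1 - l) * u1 y s powr l / U ((1 - l) *\<^sub>R x + l *\<^sub>R y) s"
  shows False
proof -
  define m where "m = (1 - l) *\<^sub>R x + l *\<^sub>R y"
  have comb: "(1 - l) *\<^sub>R v + l *\<^sub>R w \<in> \<Omega>" if "v \<in> \<Omega>" "w \<in> \<Omega>" for v w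
    using \<open>convex \<Omega>\<close> that l by (intro convexD) auto
  have "m \<in> \<Omega>" unfolding m_def by (intro comb pt)
  \<comment> \<open>The numerator factors enter \<open>OU_heat_eq_log\<close> with c = 0; only the
    denominator carries the positive source.\<close>
  have no_term: "w = (\<lambda>v r. w v r + 0 * (1 + r))" for w :: "real^'n \<Rightarrow> real \<Rightarrow> real"
    by simp
  obtain g0 d0 q0 w0 where
    g0: "((\<lambda>v. ln (u0 v s)) has_derivative (\<lambda>h. g0 \<bullet> h)) (at x)"
    and d0: "\<And>i. \<forall>\<^sub>F \<tau> in nhds 0.
           ((\<lambda>\<tau>. ln (u0 (x + \<tau> *\<^sub>R axis i 1) s)) has_real_derivative d0 i \<tau>) (at \<tau>)"
    and q0: "\<And>i. (d0 i has_real_derivative q0 i) (at 0)"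
    and w0: "((\<lambda>r. ln (u0 x r)) has_real_derivative w0) (at s)"
    and w0_eq: "w0 = (\<Sum>i\<in>UNIV. q0 i) + g0 \<bullet> g0 - x \<bullet> g0 + 0 / u0 x s"
    and ev0: "\<forall>\<^sub>F v in nhds x. v \<in> \<Omega> \<and> u0 v s > 0" "\<forall>\<^sub>F r in nhds s. u0 x r > 0"
    using OU_heat_eq_log[of u0 u0 0, OF no_term eqs(1) \<Omega>(1) pt(1,3) pos(1)] by blast
  obtain g1 d1 q1 w1 where
    g1: "((\<lambda>v. ln (u1 v s)) has_derivative (\<lambda>h. g1 \<bullet> h)) (at y)"
    and d1: "\<And>i. \<forall>\<^sub>F \<tau> in nhds 0.
           ((\<lambda>\<tau>. ln (u1 (y + \<tau> *\<^sub>R axis i 1) s)) has_real_derivative d1 i \<tau>) (at \<tau>)"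
    and q1: "\<And>i. (d1 i has_real_derivative q1 i) (at 0)"
    and w1: "((\<lambda>r. ln (u1 y r)) has_real_derivative w1) (at s)"
    and w1_eq: "w1 = (\<Sum>i\<in>UNIV. q1 i) + g1 \<bullet> g1 - y \<bullet> g1 + 0 / u1 y s"
    and ev1: "\<forall>\<^sub>F v in nhds y. v \<in> \<Omega> \<and> u1 v s > 0" "\<forall>\<^sub>F r in nhds s. u1 y r > 0"
    using OU_heat_eq_log[of u1 u1 0, OF no_term eqs(2) \<Omega>(1) pt(2,3) pos(2)] by blast
  have "U m s > 0" using pos(3) \<open>m \<in> \<Omega>\<close> pt(3) by simp
  obtain gl dl ql wl where
    gl: "((\<lambda>v. ln (U v s)) has_derivative (\<lambda>h. gl \<bullet> h)) (at m)"
    and dl: "\<And>i. \<forall>\<^sub>F \<tau> in nhds 0.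
           ((\<lambda>\<tau>. ln (U (m + \<tau> *\<^sub>R axis i 1) s)) has_real_derivative dl i \<tau>) (at \<tau>)"
    and ql: "\<And>i. (dl i has_real_derivative ql i) (at 0)"
    and wl: "((\<lambda>r. ln (U m r)) has_real_derivative wl) (at s)"
    and wl_eq: "wl = (\<Sum>i\<in>UNIV. ql i) + gl \<bullet> gl - m \<bullet> gl + c / U m s"
    and "\<forall>\<^sub>F v in nhds m. v \<in> \<Omega> \<and> U v s > 0" "\<forall>\<^sub>F r in nhds s. U m r > 0"
    using OU_heat_eq_log[of U ul c, OF U_def[THEN meta_eq_to_obj_eq] eqs(3) \<Omega>(1) \<open>m \<in> \<Omega>\<close> pt(3) \<open>U m s > 0\<close>] by blast
  \<comment> \<open>Minus the logarithm of the quotient, so the maximum becomes a minimum and the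
    three logarithms separate.\<close>
  define \<Phi> where "\<Phi> v w r = ln (U ((1 - l) *\<^sub>R v + l *\<^sub>R w) r) - (1 - l) * ln (u0 v r) - l * ln (u1 w r)"
    for v w r
  have min: "\<Phi> x y s \<le> \<Phi> v w r"
    if "v \<in> \<Omega>" "w \<in> \<Omega>" "0 < r" "r \<le> s" "u0 v r > 0" "u1 w r > 0" for v w r
  proof -
    have ln_quot: "ln (u0 v r powr (1 - l) * u1 w r powr l / U ((1 - l) *\<^sub>R v + l *\<^sub>R w) r) = - \<Phi> v w r"
      if "v \<in> \<Omega>" "w \<in> \<Omega>" "0 < r" "r \<le> s" "u0 v r > 0" "u1 w r > 0" for v w r
      using that pos(3)[OF comb[OF that(1,2)] that(3,4)] by (simp add: \<Phi>_def ln_div ln_mult ln_powr)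
    have "ln (u0 v r powr (1 - l) * u1 w r powr l / U ((1 - l) *\<^sub>R v + l *\<^sub>R w) r)
        \<le> ln (u0 x s powr (1 - l) * u1 y s powr l / U ((1 - l) *\<^sub>R x + l *\<^sub>R y) s)"
      using that pt pos(1,2) pos(3)[OF comb] max[OF that(1-4)] by (subst ln_le_cancel_iff) auto
    then show ?thesis
      using ln_quot[of v w r] ln_quot[of x y s] that pt pos(1,2) by simp
  qed
  \<comment> \<open>Only \<open>x\<close> varies here. The chain rule gives \<open>gl\<close> the
    same factor \<open>1 - l\<close> that multiplies \<open>g0\<close>, so stationarity equates the
    unweighted gradients. Varying \<open>y\<close> alone gives \<open>g1\<close> in the same
    way.\<close>
  have "gl = g0"
  proof -
    have "((\<lambda>v. (1 - l) *\<^sub>R v + l *\<^sub>R y) has_derivative (\<lambda>h. (1 - l) *\<^sub>R h)) (at x)"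
      by (auto intro!: derivative_eq_intros)
    note comp = has_derivative_compose[OF this gl[unfolded m_def]]
    have "((\<lambda>v. \<Phi> v y s) has_derivative (\<lambda>h. gl \<bullet> ((1 - l) *\<^sub>R h) - (1 - l) * (g0 \<bullet> h))) (at x)"
      unfolding \<Phi>_def
      using has_derivative_diff[OF has_derivative_diff[OF comp has_derivative_mult_right[OF g0, of "1 - l"]]
          has_derivative_const] by simp
    moreover obtain S where "open S" "x \<in> S" "\<And>v. v \<in> S \<Longrightarrow> v \<in> \<Omega> \<and> u0 v s > 0"
      using ev0(1) unfolding eventually_nhds by blast
    ultimately have "(\<lambda>h. gl \<bullet> ((1 - l) *\<^sub>R h) - (1 - l) * (g0 \<bullet> h)) = (\<lambda>h. 0)"
      using differential_zero_maxmin[of x S "\<lambda>v. \<Phi> v y s"] min pt pos by fastforce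
    then have "(1 - l) * ((gl - g0) \<bullet> h) = 0" for h
      by (simp add: fun_eq_iff algebra_simps)
    from this[of "gl - g0"] show ?thesis using l by simp
  qed
  have "gl = g1"
  proof -
    have "((\<lambda>v. (1 - l) *\<^sub>R x + l *\<^sub>R v) has_derivative (\<lambda>h. l *\<^sub>R h)) (at y)"
      by (auto intro!: derivative_eq_intros)
    note comp = has_derivative_compose[OF this gl[unfolded m_def]]
    have "((\<lambda>v. \<Phi> x v s) has_derivative (\<lambda>h. gl \<bullet> (l *\<^sub>R h) - l * (g1 \<bullet> h))) (at y)"
      unfolding \<Phi>_def
      using has_derivative_diff[OF has_derivative_diff[OF comp has_derivative_const]
          has_derivative_mult_right[OF g1, of l]] by simp
    moreover obtain S where "open S" "y \<in> S" "\<And>v. v \<in> S \<Longrightarrow> v \<in> \<Omega> \<and> u1 v s > 0"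
      using ev1(1) unfolding eventually_nhds by blast
    ultimately have "(\<lambda>h. gl \<bullet> (l *\<^sub>R h) - l * (g1 \<bullet> h)) = (\<lambda>h. 0)"
      using differential_zero_maxmin[of y S "\<lambda>v. \<Phi> x v s"] min pt pos by fastforce
    then have "l * ((gl - g1) \<bullet> h) = 0" for h
      by (auto simp: fun_eq_iff algebra_simps)
    from this[of "gl - g1"] show ?thesis using l by simp
  qed
  \<comment> \<open>The weights sum to one, so a common displacement of \<open>x\<close> and
    \<open>y\<close> displaces \<open>m\<close> equally. The second-order test then compares pure
    second derivatives in one direction, with weights 1, 1 - l and l.\<close>
  have shift: "(1 - l) *\<^sub>R (x + e) + l *\<^sub>R (y + e) = m + e" for e
    by (simp add: m_def algebra_simps)
  have second: "0 \<le> ql i - (1 - l) * q0 i - l * q1 i" for i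
  proof (rule second_deriv_local_min)
    let ?e = "\<lambda>\<tau>::real. \<tau> *\<^sub>R axis i 1 :: real^'n"
    show "\<forall>\<^sub>F \<tau> in nhds 0. ((\<lambda>\<tau>. \<Phi> (x + ?e \<tau>) (y + ?e \<tau>) s) has_real_derivative
        (\<lambda>\<tau>. dl i \<tau> - (1 - l) * d0 i \<tau> - l * d1 i \<tau>) \<tau>) (at \<tau>)"
      using dl[of i] d0[of i] d1[of i]
    proof eventually_elim
      case (elim \<tau>)
      then show ?case
        unfolding \<Phi>_def shift by (intro DERIV_diff DERIV_cmult)
    qed
    show "((\<lambda>\<tau>. dl i \<tau> - (1 - l) * d0 i \<tau> - l * d1 i \<tau>) has_real_derivative
        ql i - (1 - l) * q0 i - l * q1 i) (at 0)"
      by (intro DERIV_diff DERIV_cmult ql q0 q1)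
    have lim: "filterlim (\<lambda>\<tau>. z + ?e \<tau>) (nhds z) (nhds 0)" for z
    proof -
      have "((\<lambda>\<tau>. z + ?e \<tau>) \<longlongrightarrow> z + ?e 0) (nhds 0)" by (intro tendsto_intros filterlim_ident)
      then show ?thesis by simp
    qed
    have "\<forall>\<^sub>F \<tau> in nhds 0. x + ?e \<tau> \<in> \<Omega> \<and> u0 (x + ?e \<tau>) s > 0"
         "\<forall>\<^sub>F \<tau> in nhds 0. y + ?e \<tau> \<in> \<Omega> \<and> u1 (y + ?e \<tau>) s > 0"
      using lim ev0(1) ev1(1) unfolding filterlim_iff by blast+
    then show "\<forall>\<^sub>F \<tau> in nhds 0. \<Phi> (x + ?e 0) (y + ?e 0) s \<le> \<Phi> (x + ?e \<tau>) (y + ?e \<tau>) s"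
    proof eventually_elim
      case (elim \<tau>)
      then show ?case using min[of "x + ?e \<tau>" "y + ?e \<tau>" s] pt by simp
    qed
  qed
  have "((\<lambda>r. \<Phi> x y r) has_real_derivative wl - (1 - l) * w0 - l * w1) (at s)"
    unfolding \<Phi>_def m_def[symmetric] by (intro DERIV_diff DERIV_cmult wl w0 w1)
  moreover have "wl - (1 - l) * w0 - l * w1 > 0"
  proof -
    have "(\<Sum>i\<in>UNIV. ql i) - (1 - l) * (\<Sum>i\<in>UNIV. q0 i) - l * (\<Sum>i\<in>UNIV. q1 i) \<ge> 0"
      using sum_nonneg[of UNIV "\<lambda>i. ql i - (1 - l) * q0 i - l * q1 i"] second
      by (simp add: sum_subtractf sum_distrib_left)
    \<comment> \<open>With the common gradient \<open>gl\<close>, the squared gradients have total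
      weight 1 - (1 - l) - l = 0, and the drift terms combine to the scalar product of
      \<open>gl\<close> with m - (1 - l) x - l y = 0. Only the Laplacians and the source
      survive.\<close>
    moreover have "wl - (1 - l) * w0 - l * w1 =
        ((\<Sum>i\<in>UNIV. ql i) - (1 - l) * (\<Sum>i\<in>UNIV. q0 i) - l * (\<Sum>i\<in>UNIV. q1 i)) + c / U m s"
      unfolding wl_eq w0_eq w1_eq \<open>gl = g0\<close>[symmetric] \<open>gl = g1\<close>[symmetric] m_def
      by (simp add: algebra_simps)
    moreover have "c / U m s > 0" using \<open>c > 0\<close> \<open>U m s > 0\<close> by simp
    ultimately show ?thesis by linarith
  qed
  ultimately obtain k where "k > 0" and k: "\<And>h. h > 0 \<Longrightarrow> h < k \<Longrightarrow> \<Phi> x y (s - h) < \<Phi> x y s"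
    using DERIV_pos_inc_left by blast
  obtain e where "e > 0" and e: "\<And>r. \<bar>r - s\<bar> < e \<Longrightarrow> u0 x r > 0 \<and> u1 y r > 0"
    using eventually_conj[OF ev0(2) ev1(2)] unfolding eventually_nhds_metric
    by (auto simp: dist_real_def)
  \<comment> \<open>The backward step stays within \<open>e\<close> so that the logarithms make
    sense, within \<open>k\<close> so that \<open>\<Phi>\<close> is strictly smaller, and within
    \<open>s\<close> so that the time stays positive.\<close>
  define h where "h = Min {e, k, s} / 2"
  have h: "0 < h" "h < e" "h < k" "h < s"
    using \<open>e > 0\<close> \<open>k > 0\<close> pt(3) by (auto simp: h_def)
  have "\<Phi> x y s \<le> \<Phi> x y (s - h)"
    using h e[of "s - h"] by (intro min pt) auto
  then show False using k[of h] h by simp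
qed

section \<open>Minimum principle and comparison of three solutions\<close>

lemma OU_heat_eq_const: "OU_heat_eq (\<Omega> :: (real^'a) set) (\<lambda>_ _. k)"
  unfolding OU_heat_eq_def
proof (intro ballI allI impI)
  fix y :: "real^'a" and s :: real
  have "((\<lambda>_. 0) has_derivative (\<lambda>h. (0 :: real^'a^'a) *v h)) (at y)"
    by (simp add: matrix_vector_mult_0)
  then show "\<exists>G (H :: real^'a^'a) ut. (\<forall>w\<in>\<Omega>. ((\<lambda>v. k) has_derivative (\<lambda>h. G w \<bullet> h)) (at w)) \<and>
        (G has_derivative (\<lambda>h. H *v h)) (at y) \<and>
        ((\<lambda>r. k) has_real_derivative ut) (at s) \<and>
        ut = (\<Sum>i\<in>UNIV. H $ i $ i) - y \<bullet> G y"
    by (intro exI[of _ "\<lambda>_. 0"] exI[of _ 0] conjI) auto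
qed

lemma OU_heat_eq_add_const:
  assumes "OU_heat_eq \<Omega> u"
  shows "OU_heat_eq \<Omega> (\<lambda>v r. u v r + k)"
  unfolding OU_heat_eq_def
proof (intro ballI allI impI)
  fix y and s :: real
  assume "y \<in> \<Omega>" "s > 0"
  then obtain G H ut where *: "\<forall>w\<in>\<Omega>. ((\<lambda>v. u v s) has_derivative (\<lambda>h. G w \<bullet> h)) (at w)"
        "(G has_derivative (\<lambda>h. H *v h)) (at y)"
        "((\<lambda>r. u y r) has_real_derivative ut) (at s)"
        "ut = (\<Sum>i\<in>UNIV. H $ i $ i) - y \<bullet> G y"
    using assms unfolding OU_heat_eq_def by blast
  have "\<forall>w\<in>\<Omega>. ((\<lambda>v. u v s + k) has_derivative (\<lambda>h. G w \<bullet> h)) (at w)"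
    using *(1) has_derivative_add[OF _ has_derivative_const] by fastforce
  moreover have "((\<lambda>r. u y r + k) has_real_derivative ut) (at s)"
    using DERIV_add[OF *(3) DERIV_const] by simp
  ultimately show "\<exists>G H ut. (\<forall>w\<in>\<Omega>. ((\<lambda>v. u v s + k) has_derivative (\<lambda>h. G w \<bullet> h)) (at w)) \<and>
        (G has_derivative (\<lambda>h. H *v h)) (at y) \<and>
        ((\<lambda>r. u y r + k) has_real_derivative ut) (at s) \<and>
        ut = (\<Sum>i\<in>UNIV. H $ i $ i) - y \<bullet> G y"
    using *(2,4) by blast
qed

text \<open>Removes the perturbation c (1 + t) at the end of both comparison arguments.\<close>

lemma le_of_le_add_mult:
  fixes a b k :: real
  assumes "\<And>c. c > 0 \<Longrightarrow> a \<le> b + c * k" "k > 0"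
  shows "a \<le> b"
proof (rule field_le_epsilon)
  fix e :: real
  assume "e > 0"
  then show "a \<le> b + e" using assms(1)[of "e / k"] \<open>k > 0\<close> by simp
qed

text \<open>Adding a constant \<open>K\<close> makes \<open>u + K\<close> positive, so the two-point argument applies
  with \<open>u0 = u1 = 1\<close>.\<close>

lemma OU_minimum_principle:
  fixes u :: "real^'n \<Rightarrow> real \<Rightarrow> real"
  assumes \<Omega>: "open \<Omega>" "convex \<Omega>" "bounded \<Omega>"
    and eq: "OU_heat_eq \<Omega> u"
    and cont: "continuous_on (closure \<Omega> \<times> {0..}) (\<lambda>(x, t). u x t)"
    and init: "\<And>x. x \<in> closure \<Omega> \<Longrightarrow> 0 \<le> u x 0"
    and bdry: "\<And>x t. x \<in> closure \<Omega> - \<Omega> \<Longrightarrow> 0 \<le> t \<Longrightarrow> 0 \<le> u x t"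
    and "x \<in> closure \<Omega>" "0 \<le> t"
  shows "0 \<le> u x t"
proof (rule le_of_le_add_mult)
  show "0 < 1 + t" using \<open>0 \<le> t\<close> by simp
  fix c :: real
  assume "c > 0"
  let ?K = "closure \<Omega> \<times> {0..t}"
  have "compact ?K"
    using \<Omega>(3) by (intro compact_Times) auto
  moreover have "?K \<noteq> {}" using assms(8,9) by auto
  moreover have "continuous_on ?K (\<lambda>(x, t). u x t + c * (1 + t))"
    unfolding case_prod_beta
    by (intro continuous_intros continuous_on_subset[OF cont[unfolded case_prod_beta]]) auto
  ultimately obtain z where "z \<in> ?K"
    and z: "\<forall>y\<in>?K. (\<lambda>(x, t). u x t + c * (1 + t)) z \<le> (\<lambda>(x, t). u x t + c * (1 + t)) y"
    using continuous_attains_inf by blast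
  obtain a s where as: "z = (a, s)" "a \<in> closure \<Omega>" "0 \<le> s" "s \<le> t"
    using \<open>z \<in> ?K\<close> by auto
  have min: "u a s + c * (1 + s) \<le> u v r + c * (1 + r)" if "v \<in> closure \<Omega>" "0 \<le> r" "r \<le> t" for v r
    using z that unfolding as(1) by force
  have "0 \<le> u a s + c * (1 + s)"
  proof (rule ccontr)
    assume neg: "\<not> 0 \<le> u a s + c * (1 + s)"
    then have neg': "u a s < 0"
      using \<open>c > 0\<close> \<open>0 \<le> s\<close> by (smt (verit) mult_nonneg_nonneg)
    have "s > 0" using neg' init[OF as(2)] as(3) by (cases "s = 0") auto
    have "a \<in> \<Omega>" using neg' bdry[of a s] as by fastforce
    \<comment> \<open>Chosen so that the perturbed, shifted function has minimum exactly 1, attained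
      at \<open>(a, s)\<close>.\<close>
    define k where "k = 1 - (u a s + c * (1 + s))"
    have cl: "v \<in> closure \<Omega>" if "v \<in> \<Omega>" for v using that closure_subset by blast
    have ge1: "1 \<le> (u v r + k) + c * (1 + r)" if "v \<in> \<Omega>" "0 < r" "r \<le> s" for v r
      using min[of v r] that cl as unfolding k_def by force
    have a1: "(u a s + k) + c * (1 + s) = 1" unfolding k_def by simp
    have half: "(1/2) *\<^sub>R v + (1/2) *\<^sub>R w \<in> \<Omega>" if "v \<in> \<Omega>" "w \<in> \<Omega>" for v w
      using convexD[OF \<Omega>(2) that, of "1/2" "1/2"] by simp
    show False
    \<comment> \<open>With numerators 1 and weight 1/2 the quotient depends on \<open>v\<close> and
      \<open>w\<close> only through their midpoint, so the diagonal point \<open>(a, a)\<close>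
      maximises it.\<close>
    proof (rule OU_no_interior_max[of \<Omega> "\<lambda>_ _. 1" "\<lambda>_ _. 1" "\<lambda>v r. u v r + k" "1/2" c a a s])
      show "0 < (u v r + k) + c * (1 + r)" if "v \<in> \<Omega>" "0 < r" "r \<le> s" for v r
        using ge1[OF that] by linarith
      have aa: "(1 - 1/2) *\<^sub>R a + (1/2) *\<^sub>R a = a"
        by (simp add: scaleR_left_distrib[symmetric])
      show "1 powr (1 - 1/2) * 1 powr (1/2)
            / (u ((1 - 1/2) *\<^sub>R v + (1/2) *\<^sub>R w) r + k + c * (1 + r))
          \<le> 1 powr (1 - 1/2) * 1 powr (1/2)
            / (u ((1 - 1/2) *\<^sub>R a + (1/2) *\<^sub>R a) s + k + c * (1 + s))"
        if "v \<in> \<Omega>" "w \<in> \<Omega>" "0 < r" "r \<le> s" for v w r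
        unfolding aa a1 using ge1[OF half[OF that(1,2)] that(3,4)] by simp
    qed (use \<Omega> \<open>c > 0\<close> \<open>a \<in> \<Omega>\<close> \<open>s > 0\<close> eq in \<open>auto intro: OU_heat_eq_const OU_heat_eq_add_const\<close>)
  qed
  then show "0 \<le> u x t + c * (1 + t)" using min[of x t] assms(8,9) by simp
qed

text \<open>The perturbed quotient attains its maximum on the compact set of pairs in the closure
  and times up to \<open>t\<close>. A value above 1 is impossible on the lateral boundary, at time
  0, and, by \<open>OU_no_interior_max\<close>, anywhere else.\<close>

lemma OU_geometric_mean_comparison:
  fixes u0 u1 ul :: "real^'n \<Rightarrow> real \<Rightarrow> real"
  assumes \<Omega>: "open \<Omega>" "convex \<Omega>" "bounded \<Omega>" and l: "0 < l" "l < 1"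
    and eqs: "OU_heat_eq \<Omega> u0" "OU_heat_eq \<Omega> u1" "OU_heat_eq \<Omega> ul"
    and cont: "continuous_on (closure \<Omega> \<times> {0..}) (\<lambda>(x, t). u0 x t)"
      "continuous_on (closure \<Omega> \<times> {0..}) (\<lambda>(x, t). u1 x t)"
      "continuous_on (closure \<Omega> \<times> {0..}) (\<lambda>(x, t). ul x t)"
    and nonneg: "\<And>x t. x \<in> closure \<Omega> \<Longrightarrow> 0 \<le> t \<Longrightarrow> 0 \<le> u0 x t"
      "\<And>x t. x \<in> closure \<Omega> \<Longrightarrow> 0 \<le> t \<Longrightarrow> 0 \<le> u1 x t"
      "\<And>x t. x \<in> closure \<Omega> \<Longrightarrow> 0 \<le> t \<Longrightarrow> 0 \<le> ul x t"
    and bdry: "\<And>x t. x \<in> closure \<Omega> - \<Omega> \<Longrightarrow> 0 \<le> t \<Longrightarrow> u0 x t = 0"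
      "\<And>x t. x \<in> closure \<Omega> - \<Omega> \<Longrightarrow> 0 \<le> t \<Longrightarrow> u1 x t = 0"
    and init: "\<And>x y. x \<in> closure \<Omega> \<Longrightarrow> y \<in> closure \<Omega> \<Longrightarrow>
      u0 x 0 powr (1 - l) * u1 y 0 powr l \<le> ul ((1 - l) *\<^sub>R x + l *\<^sub>R y) 0"
    and xy: "x \<in> closure \<Omega>" "y \<in> closure \<Omega>" and "0 \<le> t"
  shows "u0 x t powr (1 - l) * u1 y t powr l \<le> ul ((1 - l) *\<^sub>R x + l *\<^sub>R y) t"
proof (rule le_of_le_add_mult)
  show "0 < 1 + t" using \<open>0 \<le> t\<close> by simp
  fix c :: real
  assume "c > 0"
  \<comment> \<open>The denominator is at least \<open>c\<close>, and the exponents 1 - l and l are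
    positive, so \<open>R\<close> is continuous even where the solutions vanish.\<close>
  define R where "R = (\<lambda>(v, w, r). u0 v r powr (1 - l) * u1 w r powr l /
      (ul ((1 - l) *\<^sub>R v + l *\<^sub>R w) r + c * (1 + r)))"
  let ?K = "closure \<Omega> \<times> closure \<Omega> \<times> {0..t}"
  have comb: "(1 - l) *\<^sub>R v + l *\<^sub>R w \<in> closure \<Omega>" if "v \<in> closure \<Omega>" "w \<in> closure \<Omega>" for v w
    using convex_closure[OF \<Omega>(2)] that l by (intro convexD) auto
  have den: "0 < ul ((1 - l) *\<^sub>R v + l *\<^sub>R w) r + c * (1 + r)"
    if "v \<in> closure \<Omega>" "w \<in> closure \<Omega>" "0 \<le> r" for v w r
    by (rule add_nonneg_pos) (use nonneg(3)[OF comb[OF that(1,2)] that(3)] \<open>c > 0\<close> that(3) in auto)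
  have "compact ?K"
    using \<Omega>(3) by (intro compact_Times) auto
  moreover have "?K \<noteq> {}" using xy \<open>0 \<le> t\<close> by auto
  moreover have "continuous_on ?K R"
  proof -
    have c0: "continuous_on ?K (\<lambda>k. u0 (fst k) (snd (snd k)))"
      by (rule continuous_on_compose2[OF cont(1)[unfolded case_prod_beta],
            of _ "\<lambda>k. (fst k, snd (snd k))", simplified]) (auto intro!: continuous_intros)
    have c1: "continuous_on ?K (\<lambda>k. u1 (fst (snd k)) (snd (snd k)))"
      by (rule continuous_on_compose2[OF cont(2)[unfolded case_prod_beta],
            of _ "\<lambda>k. (fst (snd k), snd (snd k))", simplified]) (auto intro!: continuous_intros)
    have cl: "continuous_on ?K (\<lambda>k. ul ((1 - l) *\<^sub>R fst k + l *\<^sub>R fst (snd k)) (snd (snd k)))"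
      by (rule continuous_on_compose2[OF cont(3)[unfolded case_prod_beta],
            of _ "\<lambda>k. ((1 - l) *\<^sub>R fst k + l *\<^sub>R fst (snd k), snd (snd k))", simplified])
         (auto intro!: continuous_intros comb)
    show ?thesis
      unfolding R_def case_prod_beta
    proof (intro continuous_on_divide continuous_on_mult continuous_on_powr' continuous_on_add
        c0 c1 cl continuous_on_const continuous_on_snd continuous_on_id ballI)
      fix k assume "k \<in> ?K"
      then show "ul ((1 - l) *\<^sub>R fst k + l *\<^sub>R fst (snd k)) (snd (snd k)) + c * (1 + snd (snd k)) \<noteq> 0"
        using den[of "fst k" "fst (snd k)" "snd (snd k)"] by fastforce
    qed (use l nonneg in auto)
  qed
  ultimately obtain k where "k \<in> ?K" and k: "\<forall>k'\<in>?K. R k' \<le> R k"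
    using continuous_attains_sup[of ?K R] by metis
  then obtain a b s where abs: "k = (a, b, s)" "a \<in> closure \<Omega>" "b \<in> closure \<Omega>" "0 \<le> s" "s \<le> t"
    by auto
  have max: "R (v, w, r) \<le> R (a, b, s)"
    if "v \<in> closure \<Omega>" "w \<in> closure \<Omega>" "0 \<le> r" "r \<le> t" for v w r
    using k that unfolding abs(1) by auto
  have "R (a, b, s) \<le> 1"
  proof (rule ccontr)
    assume gt: "\<not> R (a, b, s) \<le> 1"
    \<comment> \<open>Since 0 \<open>powr\<close> anything is 0, a quotient above 1 has both factors
      nonzero, which keeps \<open>a\<close> and \<open>b\<close> off the boundary.\<close>
    then have nz: "u0 a s \<noteq> 0" "u1 b s \<noteq> 0" unfolding R_def by auto
    then have "a \<in> \<Omega>" "b \<in> \<Omega>" using bdry abs by blast+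
    have pos: "u0 a s > 0" "u1 b s > 0" using nz nonneg abs by force+
    have "s \<noteq> 0"
    proof
      assume "s = 0"
      then have "R (a, b, s) \<le> 1"
        using init[OF abs(2,3)] den[OF abs(2,3), of 0] \<open>c > 0\<close> unfolding R_def by simp
      then show False using gt by simp
    qed
    then have "s > 0" using abs(4) by simp
    have cl: "v \<in> closure \<Omega>" if "v \<in> \<Omega>" for v using that closure_subset by blast
    show False
    proof (rule OU_no_interior_max[of \<Omega> u0 u1 ul l c a b s, OF eqs \<Omega>(1,2) l \<open>c > 0\<close> \<open>a \<in> \<Omega>\<close> \<open>b \<in> \<Omega>\<close> \<open>s > 0\<close> pos])
      show "0 < ul v r + c * (1 + r)" if "v \<in> \<Omega>" "0 < r" "r \<le> s" for v r
        by (rule add_nonneg_pos) (use nonneg(3)[of v r] cl that \<open>c > 0\<close> in auto)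
      show "u0 v r powr (1 - l) * u1 w r powr l / (ul ((1 - l) *\<^sub>R v + l *\<^sub>R w) r + c * (1 + r))
        \<le> u0 a s powr (1 - l) * u1 b s powr l / (ul ((1 - l) *\<^sub>R a + l *\<^sub>R b) s + c * (1 + s))"
        if "v \<in> \<Omega>" "w \<in> \<Omega>" "0 < r" "r \<le> s" for v w r
        using max[of v w r] that cl abs(5) unfolding R_def by simp
    qed
  qed
  then have "R (x, y, t) \<le> 1" using max[OF xy \<open>0 \<le> t\<close>] by simp
  then show "u0 x t powr (1 - l) * u1 y t powr l \<le> ul ((1 - l) *\<^sub>R x + l *\<^sub>R y) t + c * (1 + t)"
    using den[OF xy \<open>0 \<le> t\<close>] unfolding R_def by (simp add: divide_le_eq)
qed

section \<open>Tent functions: log-concave bumps forming an approximate identity\<close>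

text \<open>A bump that is concave on its support. It is not smooth, but \<open>Cc_on\<close> asks
  only for continuity and compact support.\<close>

definition tent :: "real \<Rightarrow> 'a::real_normed_vector \<Rightarrow> real" where
  "tent r z = max 0 (1 - norm z / r)"

lemma tent_nonneg: "0 \<le> tent r z"
  by (simp add: tent_def)

lemma tent_eq_0: "r > 0 \<Longrightarrow> norm z \<ge> r \<Longrightarrow> tent r z = 0"
  by (simp add: tent_def max_def field_simps)

lemma continuous_on_tent: "continuous_on S (\<lambda>z. tent r (z - a))"
  unfolding tent_def divide_inverse by (intro continuous_intros)

text \<open>If one tent value is 0, the left side is 0. Otherwise Young's inequality bounds the
  geometric mean by the arithmetic mean, and 1 - |z| / r is concave by the triangle
  inequality.\<close>

lemma tent_log_concave:
  assumes "r > 0" "0 < l" "l < 1"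
  shows "tent r a powr (1 - l) * tent r b powr l \<le> tent r ((1 - l) *\<^sub>R a + l *\<^sub>R b)"
proof (cases "tent r a = 0 \<or> tent r b = 0")
  case True
  then show ?thesis using tent_nonneg[of r] by auto
next
  case False
  then have ab: "tent r a = 1 - norm a / r" "tent r b = 1 - norm b / r"
    by (auto simp: tent_def max_def split: if_splits)
  have "tent r a powr (1 - l) * tent r b powr l \<le> (1 - l) * tent r a + l * tent r b"
    using assms False tent_nonneg[of r a] tent_nonneg[of r b] by (intro Youngs_inequality_0) auto
  also have "\<dots> = 1 - ((1 - l) * norm a + l * norm b) / r"
    unfolding ab using assms(1) by (simp add: field_simps)
  also have "\<dots> \<le> 1 - norm ((1 - l) *\<^sub>R a + l *\<^sub>R b) / r"
    using norm_triangle_ineq[of "(1 - l) *\<^sub>R a" "l *\<^sub>R b"] assms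
    by (intro diff_left_mono divide_right_mono) auto
  also have "\<dots> \<le> tent r ((1 - l) *\<^sub>R a + l *\<^sub>R b)"
    by (simp add: tent_def)
  finally show ?thesis .
qed

lemma Cc_on_tent:
  assumes "r > 0" "cball a r \<subseteq> \<Omega>"
  shows "Cc_on \<Omega> (\<lambda>z. tent r (z - a))"
  unfolding Cc_on_def
proof (intro conjI exI[of _ "cball a r"])
  show "\<forall>z. z \<notin> cball a r \<longrightarrow> tent r (z - a) = 0"
    using assms(1) by (auto intro!: tent_eq_0 simp: dist_norm norm_minus_commute)
qed (use assms(2) in \<open>auto intro: continuous_on_tent\<close>)

text \<open>By translation invariance one constant serves every centre and every set containing the
  ball. It is positive because a continuous nonnegative function with zero integral over a box
  vanishes there, while the tent is 1 at its centre.\<close>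

lemma tent_has_integral:
  fixes r :: real
  assumes "r > 0"
  obtains I where "I > 0"
    "\<And>a \<Omega>. cball (a :: 'a::euclidean_space) r \<subseteq> \<Omega> \<Longrightarrow> ((\<lambda>z. tent r (z - a)) has_integral I) \<Omega>"
proof -
  let ?l = "- r *\<^sub>R One :: 'a" and ?u = "r *\<^sub>R One :: 'a"
  have cont: "continuous_on (cbox ?l ?u) (tent r :: 'a \<Rightarrow> real)"
    using continuous_on_tent[of _ r 0] by simp
  then obtain I where I: "((tent r :: 'a \<Rightarrow> real) has_integral I) (cbox ?l ?u)"
    using integrable_continuous by blast
  have "I \<ge> 0" using I by (rule has_integral_nonneg) (rule tent_nonneg)
  moreover have "I \<noteq> 0"
  proof
    assume "I = 0"
    then have "tent r (0 :: 'a) = 0"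
      using I assms by (intro has_integral_0_cbox_imp_0[OF cont tent_nonneg])
         (auto simp: mem_box box_ne_empty)
    then show False by (simp add: tent_def)
  qed
  ultimately have "I > 0" by simp
  moreover have "((\<lambda>z. tent r (z - a)) has_integral I) \<Omega>" if "cball a r \<subseteq> \<Omega>" for a :: 'a and \<Omega>
  proof -
    have zero: "tent r (z - a) = 0" if "z \<notin> cball a r" for z
      using that assms by (intro tent_eq_0) (auto simp: dist_norm norm_minus_commute)
    have "((\<lambda>z. tent r (z - a)) has_integral I) (cbox (?l + a) (?u + a))"
      using has_integral_shift_cbox[OF I, of "-a"] by simp
    moreover have "cball a r \<subseteq> cbox (?l + a) (?u + a)"
    proof
      fix z assume "z \<in> cball a r"
      then have "\<bar>(z - a) \<bullet> b\<bar> \<le> r" if "b \<in> Basis" for b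
        using Basis_le_norm[OF that, of "z - a"] by (simp add: dist_norm norm_minus_commute)
      then show "z \<in> cbox (?l + a) (?u + a)"
        by (fastforce simp: mem_box inner_add_left inner_diff_left abs_le_iff)
    qed
    ultimately have "((\<lambda>z. tent r (z - a)) has_integral I) UNIV"
      using zero by (intro has_integral_on_superset[where T=UNIV and f="\<lambda>z. tent r (z - a)"]) blast+
    moreover have "(\<lambda>z. tent r (z - a)) = (\<lambda>z. if z \<in> \<Omega> then tent r (z - a) else 0)"
      using zero that by (intro ext) (metis subsetD)
    ultimately show ?thesis
      using has_integral_restrict_UNIV[of \<Omega> "\<lambda>z. tent r (z - a)"] by metis
  qed
  ultimately show thesis by (rule that)
qed

text \<open>The type argument fixes the space, which the radius alone does not determine.\<close>

definition tent_mass :: "'a::euclidean_space itself \<Rightarrow> real \<Rightarrow> real" where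
  "tent_mass _ r = integral UNIV (tent r :: 'a \<Rightarrow> real)"

lemma tent_mass:
  assumes "r > 0"
  shows "tent_mass TYPE('a::euclidean_space) r > 0"
    and "cball (a :: 'a) r \<subseteq> \<Omega> \<Longrightarrow>
      ((\<lambda>z. tent r (z - a)) has_integral tent_mass TYPE('a) r) \<Omega>"
proof -
  obtain I where I: "I > 0"
    "\<And>a \<Omega>. cball (a :: 'a) r \<subseteq> \<Omega> \<Longrightarrow> ((\<lambda>z. tent r (z - a)) has_integral I) \<Omega>"
    using tent_has_integral[OF assms] by metis
  have "tent_mass TYPE('a) r = I"
    unfolding tent_mass_def using I(2)[of 0 UNIV] by (simp add: integral_unique)
  then show "tent_mass TYPE('a) r > 0"
    and "cball (a :: 'a) r \<subseteq> \<Omega> \<Longrightarrow>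
      ((\<lambda>z. tent r (z - a)) has_integral tent_mass TYPE('a) r) \<Omega>"
    using I by auto
qed

text \<open>For small \<open>r\<close>, \<open>h\<close> differs from \<open>h a\<close> by less
  than e / 2 wherever the tent is nonzero, so the integral lies between (h a - e / 2) and (h a + e /
  2) times the mass.\<close>

lemma tent_approximate_identity:
  fixes h :: "'a::euclidean_space \<Rightarrow> real"
  assumes "open \<Omega>" "a \<in> \<Omega>" "continuous_on \<Omega> h"
    and int: "\<And>r. r > 0 \<Longrightarrow> cball a r \<subseteq> \<Omega> \<Longrightarrow> (\<lambda>z. h z * tent r (z - a)) integrable_on \<Omega>"
  shows "((\<lambda>r. integral \<Omega> (\<lambda>z. h z * tent r (z - a)) / tent_mass TYPE('a) r) \<longlongrightarrow> h a) (at_right 0)"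
proof (rule tendstoI)
  fix e :: real
  assume "e > 0"
  have "isCont h a" using assms continuous_on_eq_continuous_at by blast
  then obtain d1 where "d1 > 0" and d1: "\<And>z. dist z a < d1 \<Longrightarrow> \<bar>h z - h a\<bar> < e / 2"
    using \<open>e > 0\<close> unfolding continuous_at_eps_delta dist_real_def by (metis half_gt_zero)
  obtain d2 where "d2 > 0" and d2: "cball a d2 \<subseteq> \<Omega>"
    using assms(1,2) open_contains_cball by blast
  have "\<forall>\<^sub>F r in at_right 0. 0 < r \<and> r < min d1 d2"
    using \<open>d1 > 0\<close> \<open>d2 > 0\<close> eventually_at_right_real[of 0 "min d1 d2"] by (auto simp: eventually_mono)
  then show "\<forall>\<^sub>F r in at_right 0.
      dist (integral \<Omega> (\<lambda>z. h z * tent r (z - a)) / tent_mass TYPE('a) r) (h a) < e"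
  proof eventually_elim
    case (elim r)
    let ?f = "\<lambda>z. h z * tent r (z - a)" and ?I = "tent_mass TYPE('a) r"
    have sub: "cball a r \<subseteq> \<Omega>" using elim d2 by auto
    have "?I > 0" using tent_mass(1) elim by blast
    have I: "((\<lambda>z. tent r (z - a)) has_integral ?I) \<Omega>" using tent_mass(2) elim sub by blast
    have f: "(?f has_integral integral \<Omega> ?f) \<Omega>" using int[OF _ sub] elim by (simp add: integrable_integral)
    have bnd: "(h a - e / 2) * tent r (z - a) \<le> ?f z \<and> ?f z \<le> (h a + e / 2) * tent r (z - a)" for z
    proof (cases "dist z a < d1")
      case True
      then show ?thesis
        using d1[OF True] unfolding abs_less_iff
        by (intro conjI mult_right_mono tent_nonneg) linarith+
    next
      case False
      then show ?thesis using elim tent_eq_0[of r "z - a"] by (simp add: dist_norm)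
    qed
    have "(h a - e / 2) * ?I \<le> integral \<Omega> ?f"
      using has_integral_le[OF has_integral_mult_right[OF I, of "h a - e / 2"] f] bnd by blast
    moreover have "integral \<Omega> ?f \<le> (h a + e / 2) * ?I"
      using has_integral_le[OF f has_integral_mult_right[OF I, of "h a + e / 2"]] bnd by blast
    ultimately have "h a - e / 2 \<le> integral \<Omega> ?f / ?I" "integral \<Omega> ?f / ?I \<le> h a + e / 2"
      using \<open>?I > 0\<close> by (auto simp: field_simps)
    then show ?case using \<open>e > 0\<close> by (simp add: dist_real_def abs_less_iff)
  qed
qed

section \<open>Log-concavity of the kernel\<close>

lemma log_concave_onI:
  assumes nonneg: "\<And>x. x \<in> C \<Longrightarrow> 0 \<le> g x"
    and le: "\<And>a b s. a \<in> C \<Longrightarrow> b \<in> C \<Longrightarrow> 0 < s \<Longrightarrow> s < 1 \<Longrightarrow>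
      g a powr (1 - s) * g b powr s \<le> g ((1 - s) *\<^sub>R a + s *\<^sub>R b)"
  shows "log_concave_on C g"
  unfolding log_concave_on_def Let_def
proof (intro conjI ballI allI impI)
  fix a b and s :: real
  assume ab: "a \<in> C" "b \<in> C" and s: "0 < s \<and> s < 1"
  let ?L = "\<lambda>x. if g x = 0 then - \<infinity> else ereal (ln (g x))"
  let ?m = "(1 - s) *\<^sub>R a + s *\<^sub>R b"
  show "ereal (1 - s) * ?L a + ereal s * ?L b \<le> ?L ?m"
  proof (cases "g a = 0 \<or> g b = 0")
    \<comment> \<open>Both weights are positive, so one value of minus infinity makes the whole left
      side minus infinity.\<close>
    case True
    then show ?thesis using s by auto
  next
    case False
    then have pos: "g a > 0" "g b > 0" using nonneg ab by force+
    have prod: "0 < g a powr (1 - s) * g b powr s" using pos by simp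
    also have le': "\<dots> \<le> g ?m" using le ab s by blast
    finally have "g ?m > 0" .
    have "(1 - s) * ln (g a) + s * ln (g b) = ln (g a powr (1 - s) * g b powr s)"
      using pos by (simp add: ln_mult ln_powr)
    also have "\<dots> \<le> ln (g ?m)" using le' prod \<open>g ?m > 0\<close> by simp
    finally show ?thesis using pos \<open>g ?m > 0\<close> by simp
  qed
qed (fact nonneg)

theorem theorem1p2:
  fixes \<Omega> :: "(real^'n) set"
    and p :: "real^'n \<Rightarrow> real^'n \<Rightarrow> real \<Rightarrow> real"
    and t :: real
  assumes "CARD('n) \<ge> 2"
    and "bounded \<Omega>" and "convex \<Omega>" and "open \<Omega>"
    and "OU_dirichlet_kernel \<Omega> p"
    and "t > 0"
  shows "log_concave_on (\<Omega> \<times> \<Omega>) (\<lambda>(x, z). p x z t * exp (- (norm z)\<^sup>2 / 2))"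
proof -
  note \<Omega> = \<open>open \<Omega>\<close> \<open>convex \<Omega>\<close> \<open>bounded \<Omega>\<close>
  define k where "k = (2 * pi) powr (- real CARD('n) / 2)"
  have "k > 0" by (simp add: k_def)
  let ?q = "\<lambda>(x, z). p x z t * exp (- (norm z)\<^sup>2 / 2)"
  let ?I = "tent_mass TYPE(real^'n)"
  let ?u = "\<lambda>z r. kernel_sol \<Omega> p (\<lambda>w. tent r (w - z))"
  have p_cont: "continuous_on (\<Omega> \<times> \<Omega> \<times> {0<..}) (\<lambda>(x, z, t). p x z t)"
    and kernel: "\<And>f. Cc_on \<Omega> f \<Longrightarrow>
        (\<forall>x\<in>\<Omega>. \<forall>t>0. (\<lambda>z. p x z t * f z * gauss_dens z) integrable_on \<Omega>) \<and>
        continuous_on (closure \<Omega> \<times> {0..}) (\<lambda>(x, t). kernel_sol \<Omega> p f x t) \<and>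
        OU_heat_eq \<Omega> (kernel_sol \<Omega> p f)"
    using \<open>OU_dirichlet_kernel \<Omega> p\<close> unfolding OU_dirichlet_kernel_def by blast+
  \<comment> \<open>At nonzero times this is built into \<open>kernel_sol\<close>; at time 0 the
    value is that of the tent, whose supporting ball lies in the open set.\<close>
  have bdry: "?u z r x s = 0" if "r > 0" "cball z r \<subseteq> \<Omega>" "x \<in> closure \<Omega> - \<Omega>" for z r x s
  proof -
    have "x \<notin> cball z r" using that by auto
    then have "tent r (x - z) = 0"
      using that(1) by (intro tent_eq_0) (auto simp: dist_norm norm_minus_commute)
    then show ?thesis using that(3) by (simp add: kernel_sol_def)
  qed
  \<comment> \<open>\<open>OU_dirichlet_kernel\<close> says nothing about the sign of
    \<open>p\<close>. The minimum principle gives it for the solutions started from tents, and the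
    limit below transfers it to the kernel.\<close>
  have nonneg: "0 \<le> ?u z r x s" if r: "r > 0" "cball z r \<subseteq> \<Omega>" and "x \<in> closure \<Omega>" "0 \<le> s" for z r x s
  proof (rule OU_minimum_principle[OF \<Omega> _ _ _ _ that(3,4)])
    show "OU_heat_eq \<Omega> (?u z r)" "continuous_on (closure \<Omega> \<times> {0..}) (\<lambda>(x, t). ?u z r x t)"
      using kernel[OF Cc_on_tent[OF r]] by auto
    show "0 \<le> ?u z r x 0" for x by (simp add: kernel_sol_def tent_nonneg)
    show "0 \<le> ?u z r x t" if "x \<in> closure \<Omega> - \<Omega>" for x t
      using bdry[OF r that] by simp
  qed
  have ev: "\<forall>\<^sub>F r in at_right 0. r > 0 \<and> cball z r \<subseteq> \<Omega>" if z: "z \<in> \<Omega>" for z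
  proof -
    obtain d where "d > 0" "cball z d \<subseteq> \<Omega>"
      using \<open>open \<Omega>\<close> z unfolding open_contains_cball by blast
    moreover from this have "\<forall>\<^sub>F r in at_right 0. r \<in> {0<..<d}"
      by (intro eventually_at_right_real)
    ultimately show ?thesis by (elim eventually_mono) auto
  qed
  \<comment> \<open>Shrinking normalised tents recover the kernel pointwise in \<open>z\<close>. The
    Gaussian factor appears because \<open>kernel_sol\<close> integrates against
    \<open>gauss_dens\<close>.\<close>
  have lim: "((\<lambda>r. ?u z r x t / ?I r) \<longlongrightarrow> k * ?q (x, z)) (at_right 0)"
    if "x \<in> \<Omega>" "z \<in> \<Omega>" for x z
  proof -
    define h where "h = (\<lambda>w. p x w t * gauss_dens w)"
    have "continuous_on \<Omega> (\<lambda>w. p x w t)"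
      by (rule continuous_on_compose2[OF p_cont, of _ "\<lambda>w. (x, w, t)", simplified])
         (use that \<open>t > 0\<close> in \<open>auto intro!: continuous_intros\<close>)
    then have "continuous_on \<Omega> h"
      unfolding h_def gauss_dens_def by (intro continuous_intros) auto
    moreover have "(\<lambda>w. h w * tent r (w - z)) integrable_on \<Omega>" if "r > 0" "cball z r \<subseteq> \<Omega>" for r
      using kernel[OF Cc_on_tent[OF that]] \<open>x \<in> \<Omega>\<close> \<open>t > 0\<close> unfolding h_def by (simp add: mult_ac)
    ultimately have "((\<lambda>r. integral \<Omega> (\<lambda>w. h w * tent r (w - z)) / ?I r) \<longlongrightarrow> h z) (at_right 0)"
      by (intro tent_approximate_identity \<Omega> \<open>z \<in> \<Omega>\<close>)
    moreover have "integral \<Omega> (\<lambda>w. h w * tent r (w - z)) = ?u z r x t" for r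
      using \<open>x \<in> \<Omega>\<close> \<open>t > 0\<close> unfolding h_def kernel_sol_def by (simp add: mult_ac)
    moreover have "h z = k * ?q (x, z)"
      unfolding h_def gauss_dens_def k_def by simp
    ultimately show ?thesis by simp
  qed
  have cl: "x \<in> closure \<Omega>" if "x \<in> \<Omega>" for x using that closure_subset by blast
  have q_nonneg: "0 \<le> ?q (x, z)" if "x \<in> \<Omega>" "z \<in> \<Omega>" for x z
  proof -
    have "\<forall>\<^sub>F r in at_right 0. 0 \<le> ?u z r x t / ?I r"
      using ev[OF \<open>z \<in> \<Omega>\<close>]
    proof eventually_elim
      case (elim r)
      then show ?case
        using nonneg[of r z x t] tent_mass(1)[of r, where 'a="real^'n"] cl[OF \<open>x \<in> \<Omega>\<close>] \<open>t > 0\<close> by simp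
    qed
    with lim[OF that] have "0 \<le> k * ?q (x, z)"
      by (rule tendsto_lowerbound) simp
    then show ?thesis using \<open>k > 0\<close> by (simp add: zero_le_mult_iff)
  qed
  have main: "?q (x0, z0) powr (1 - l) * ?q (x1, z1) powr l
      \<le> ?q ((1 - l) *\<^sub>R x0 + l *\<^sub>R x1, (1 - l) *\<^sub>R z0 + l *\<^sub>R z1)"
    if x: "x0 \<in> \<Omega>" "x1 \<in> \<Omega>" and z: "z0 \<in> \<Omega>" "z1 \<in> \<Omega>" and l: "0 < l" "l < 1" for x0 x1 z0 z1 l
  proof -
    let ?x = "(1 - l) *\<^sub>R x0 + l *\<^sub>R x1" and ?z = "(1 - l) *\<^sub>R z0 + l *\<^sub>R z1"
    have xl: "?x \<in> \<Omega>" and zl: "?z \<in> \<Omega>"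
      using \<open>convex \<Omega>\<close> x z l by (auto intro!: convexD)
    have "\<forall>\<^sub>F r in at_right 0. 0 \<le> ?u z0 r x0 t / ?I r \<and> 0 \<le> ?u z1 r x1 t / ?I r \<and>
      (?u z0 r x0 t / ?I r) powr (1 - l) * (?u z1 r x1 t / ?I r) powr l \<le> ?u ?z r ?x t / ?I r"
      using ev[OF z(1)] ev[OF z(2)] ev[OF zl]
    proof eventually_elim
      case (elim r)
      have "?I r > 0" using elim tent_mass(1) by blast
      have "?u z0 r x0 t powr (1 - l) * ?u z1 r x1 t powr l \<le> ?u ?z r ?x t"
      proof (rule OU_geometric_mean_comparison[where ?u0.0="?u z0 r" and ?u1.0="?u z1 r" and ul="?u ?z r", OF \<Omega> l])
        show "?u z0 r x 0 powr (1 - l) * ?u z1 r y 0 powr l \<le> ?u ?z r ((1 - l) *\<^sub>R x + l *\<^sub>R y) 0" for x y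
        proof -
          \<comment> \<open>Centring the third tent at \<open>?z\<close> makes displacements from
            the centres combine with the same weights as the points, so the initial inequality is
            exactly \<open>tent_log_concave\<close>.\<close>
          have "(1 - l) *\<^sub>R x + l *\<^sub>R y - ?z = (1 - l) *\<^sub>R (x - z0) + l *\<^sub>R (y - z1)"
            by (simp add: algebra_simps)
          then show ?thesis
            using tent_log_concave[of r l "x - z0" "y - z1"] elim l by (simp add: kernel_sol_def)
        qed
      qed (use elim kernel[OF Cc_on_tent] nonneg bdry cl x \<open>t > 0\<close> in auto)
      moreover have "0 \<le> ?u z0 r x0 t" "0 \<le> ?u z1 r x1 t"
        using elim nonneg cl x \<open>t > 0\<close> by auto
      \<comment> \<open>All three tents have the same mass and the exponents sum to 1, so
        normalising preserves the inequality.\<close>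
      moreover have "(?I r) powr (1 - l) * (?I r) powr l = ?I r"
        using \<open>?I r > 0\<close> by (simp add: powr_add[symmetric])
      ultimately show ?case
        using \<open>?I r > 0\<close>
        by (simp add: powr_divide divide_right_mono)
    qed
    note ev_all = this
    have "(k * ?q (x0, z0)) powr (1 - l) * (k * ?q (x1, z1)) powr l \<le> k * ?q (?x, ?z)"
    proof (rule tendsto_le[OF _ lim[OF xl zl]])
      show "((\<lambda>r. (?u z0 r x0 t / ?I r) powr (1 - l) * (?u z1 r x1 t / ?I r) powr l) \<longlongrightarrow>
          (k * ?q (x0, z0)) powr (1 - l) * (k * ?q (x1, z1)) powr l) (at_right 0)"
        \<comment> \<open>The limits may be 0; the powers still converge because the exponents are
          positive and the bases are eventually nonnegative.\<close>
        by (intro tendsto_mult tendsto_powr' lim x z tendsto_const disjI2 conjI)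
           (use l ev_all in \<open>auto elim: eventually_mono\<close>)
      show "\<forall>\<^sub>F r in at_right 0.
          (?u z0 r x0 t / ?I r) powr (1 - l) * (?u z1 r x1 t / ?I r) powr l \<le> ?u ?z r ?x t / ?I r"
        using ev_all by (auto elim: eventually_mono)
    qed simp
    moreover have "(k * ?q (x0, z0)) powr (1 - l) * (k * ?q (x1, z1)) powr l
        = k * (?q (x0, z0) powr (1 - l) * ?q (x1, z1) powr l)"
    proof -
      have "k powr (1 - l) * k powr l = k"
        using \<open>k > 0\<close> by (simp add: powr_add[symmetric])
      then have "k powr (1 - l) * a * (k powr l * b) = k * (a * b)" for a b
        by (metis mult.assoc mult.left_commute)
      then show ?thesis
        using \<open>k > 0\<close> q_nonneg x z by (simp only: powr_mult)
    qed
    ultimately show ?thesis using \<open>k > 0\<close> by simp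
  qed
  show ?thesis
  proof (rule log_concave_onI)
    show "0 \<le> ?q a" if "a \<in> \<Omega> \<times> \<Omega>" for a
      using that q_nonneg by (cases a) blast
    show "?q a powr (1 - l) * ?q b powr l \<le> ?q ((1 - l) *\<^sub>R a + l *\<^sub>R b)"
      if "a \<in> \<Omega> \<times> \<Omega>" "b \<in> \<Omega> \<times> \<Omega>" "0 < l" "l < 1" for a b l
      using that main[of "fst a" "fst b" "snd a" "snd b" l] by (cases a; cases b) simp
  qed
qed

end
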